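(* Let $G$ be a simple graph and let $K_{s_1},K_{s_2},\ldots,K_{s_k}$ be pairwise edge-disjoint cliques (complete subgraphs) of $G$ with $s_i\ge 3$ for all $i$. Then $G$ has at least $\sum_{i=1}^{k}\frac{\binom{s_i}{3}}{1+3(s_i-3)}$ $\mathcal{H}$-eigenvalues (counted with multiplicity) not less than $3$.
   Context: For an oriented edge $e$ write $e^-$ for its tail and $e^+$ for its head. For distinct edges $e,e'$: $e\leftrightarrow e'$ means $e^+=e'^-$ or $e'^+=e^-$; $e\overset{\pm}{\sim}e'$ means $e^+=e'^+$ or $e^-=e'^-$; $e\vartriangle e'$ means $e,e'$ are two edges of a common triangle. $\triangle(e)$ is the number of triangles containing $e$. The Helmholtzian matrix $\mathcal{H}(G)=(h_{ee'})$ is indexed by edges, with $h_{ee}=\triangle(e)+2$, and for $e\ne e'$: $h_{ee'}=-1$ if $e\leftrightarrow e'$ and not $e\vartriangle e'$; $h_{ee'}=1$ if $e\overset{\pm}{\sim}e'$ and not $e\vartriangle e'$; $h_{ee'}=0$ otherwise. The $\mathcal{H}$-eigenvalues of $G$ are the eigenvalues of $\mathcal{H}(G)$ for an arbitrary edge orientation (independent of the orientation). *)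

theory Defs
  imports "Jordan_Normal_Form.Char_Poly"
begin

text \<open>A simple graph on the finite vertex set V, given together with an arbitrary
orientation of its edges: es lists every edge exactly once, as an oriented pair
(tail, head).\<close>

definition undir :: "'a \<times> 'a \<Rightarrow> 'a set" where
  "undir e = {fst e, snd e}"

definition oriented_simple_graph :: "'a set \<Rightarrow> ('a \<times> 'a) list \<Rightarrow> bool" where
  "oriented_simple_graph V es \<longleftrightarrow> finite V \<and>
     (\<forall>e \<in> set es. fst e \<in> V \<and> snd e \<in> V \<and> fst e \<noteq> snd e) \<and>
     distinct (map undir es)"

definition adj :: "('a \<times> 'a) list \<Rightarrow> 'a \<Rightarrow> 'a \<Rightarrow> bool" where
  "adj es u v \<longleftrightarrow> {u, v} \<in> undir ` set es \<and> u \<noteq> v"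

definition ntri :: "'a set \<Rightarrow> ('a \<times> 'a) list \<Rightarrow> 'a \<times> 'a \<Rightarrow> nat" where
  "ntri V es e = card {w \<in> V. adj es w (fst e) \<and> adj es w (snd e)}"

definition in_common_tri :: "('a \<times> 'a) list \<Rightarrow> 'a \<times> 'a \<Rightarrow> 'a \<times> 'a \<Rightarrow> bool" where
  "in_common_tri es e e' \<longleftrightarrow> undir e \<noteq> undir e' \<and>
     (\<exists>a b c. adj es a b \<and> adj es b c \<and> adj es a c \<and>
        undir e \<subseteq> {a, b, c} \<and> undir e' \<subseteq> {a, b, c})"

definition head_tail :: "'a \<times> 'a \<Rightarrow> 'a \<times> 'a \<Rightarrow> bool" where
  "head_tail e e' \<longleftrightarrow> snd e = fst e' \<or> snd e' = fst e"

definition same_end :: "'a \<times> 'a \<Rightarrow> 'a \<times> 'a \<Rightarrow> bool" where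
  "same_end e e' \<longleftrightarrow> snd e = snd e' \<or> fst e = fst e'"

definition helm_entry :: "'a set \<Rightarrow> ('a \<times> 'a) list \<Rightarrow> 'a \<times> 'a \<Rightarrow> 'a \<times> 'a \<Rightarrow> real" where
  "helm_entry V es e e' =
     (if e = e' then real (ntri V es e) + 2
      else if head_tail e e' \<and> \<not> in_common_tri es e e' then -1
      else if same_end e e' \<and> \<not> in_common_tri es e e' then 1
      else 0)"

definition helmholtzian :: "'a set \<Rightarrow> ('a \<times> 'a) list \<Rightarrow> real mat" where
  "helmholtzian V es = mat (length es) (length es) (\<lambda>(i, j). helm_entry V es (es ! i) (es ! j))"

definition num_eigs_ge :: "real mat \<Rightarrow> real \<Rightarrow> nat" where
  "num_eigs_ge A c = (\<Sum>r \<in> {r. poly (char_poly A) r = 0 \<and> r \<ge> c}. order r (char_poly A))"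

definition is_clique :: "('a \<times> 'a) list \<Rightarrow> 'a set \<Rightarrow> bool" where
  "is_clique es S \<longleftrightarrow> (\<forall>u \<in> S. \<forall>v \<in> S. u \<noteq> v \<longrightarrow> adj es u v)"

end

theory Submission
  imports Defs "Jordan_Normal_Form.Schur_Decomposition"
begin

text \<open>The Helmholtzian is the Hodge Laplacian of the clique complex: its quadratic form at an
  edge weighting is the sum of the squared divergences at the vertices and of the squared
  circulations around all triangles. Restricting the second sum to an edge-disjoint family of
  triangles, whose unit flows are orthogonal of squared norm 3, shows that the form is at least
  3 times the squared norm on their span, so there are as many eigenvalues not less than 3 as
  triangles in the family. In a clique on s vertices, a maximal edge-disjoint family of triangles
  blocks every triangle, and each member blocks at most 1 + 3(s - 3) triangles. Families from
  edge-disjoint cliques can be combined.\<close>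

section \<open>Spectral decomposition of real symmetric matrices\<close>

text \<open>For a combination of the flows, edge-disjointness keeps the Gram matrix diagonal: the
  circulation around each member triangle is 3 times its own coefficient. The squared circulations
  thus total 9 times the sum of squared coefficients, while the squared norm is 3 times that sum,
  and the quotient is exactly 3. No eigenvalue is ever computed. What has to be bridged is the gap
  between a lower bound of the form on a subspace and multiplicities of roots of the characteristic
  polynomial; an orthonormal eigenbasis over the reals does this, hence the spectral theorem comes
  first.\<close>

lemma real_symmetric_eigenvalue_exists:
  fixes A :: "real mat"
  assumes A: "A \<in> carrier_mat n n" and sym: "transpose_mat A = A" and n: "n \<noteq> 0"
  shows "\<exists>a. eigenvalue A a"
proof -
  let ?C = "map_mat complex_of_real A"
  have C: "?C \<in> carrier_mat n n" using A by simp
  from char_poly_factorized[OF C] obtain as where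
    as: "char_poly ?C = (\<Prod>a\<leftarrow>as. [:- a, 1:])" "length as = n" by blast
  from n as(2) obtain a bs where "as = a # bs" by (cases as) auto
  with as(1) have "poly (char_poly ?C) a = 0" by simp
  then have root: "eigenvalue ?C a" using eigenvalue_root_char_poly[OF C] by simp
  then obtain v where v: "v \<in> carrier_vec n" "v \<noteq> 0\<^sub>v n" "?C *\<^sub>v v = a \<cdot>\<^sub>v v"
    using C unfolding eigenvalue_def eigenvector_def by auto
  have symC: "transpose_mat ?C = ?C"
    using sym by (metis map_mat_transpose)
  have entry: "cnj (?C $$ (i, j)) = ?C $$ (j, i)" if "i < n" "j < n" for i j
  proof -
    have "A $$ (i, j) = A $$ (j, i)"
      using sym A that by (metis carrier_matD index_transpose_mat(1))
    then show ?thesis using A that by simp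
  qed
  \<comment> \<open>The entries are real, so conjugation sends eigenvectors for \<open>a\<close> to
    eigenvectors for \<open>cnj a\<close>. By symmetry, pairing \<open>?C *\<^sub>v v\<close> with
    the conjugate of \<open>v\<close> then gives both \<open>a\<close> and \<open>cnj a\<close>
    times the nonzero squared norm of \<open>v\<close>, which forces \<open>a\<close> to be
    real.\<close>
  have conj_eig: "?C *\<^sub>v conjugate v = cnj a \<cdot>\<^sub>v conjugate v"
  proof (rule eq_vecI)
    fix i assume "i < dim_vec (cnj a \<cdot>\<^sub>v conjugate v)"
    then have i: "i < n" using v by simp
    have "(?C *\<^sub>v conjugate v) $ i = (\<Sum>j<n. complex_of_real (A $$ (i, j)) * cnj (v $ j))"
      using A v i by (simp add: scalar_prod_def lessThan_atLeast0)
    also have "\<dots> = cnj ((?C *\<^sub>v v) $ i)"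
      using A v(1) i by (simp add: scalar_prod_def lessThan_atLeast0)
    also have "\<dots> = (cnj a \<cdot>\<^sub>v conjugate v) $ i"
      using v i by simp
    finally show "(?C *\<^sub>v conjugate v) $ i = (cnj a \<cdot>\<^sub>v conjugate v) $ i" .
  qed (use A v in simp)
  have cv: "conjugate v \<in> carrier_vec n" using v by simp
  have "a * (v \<bullet>c v) = (?C *\<^sub>v v) \<bullet> conjugate v" using v cv by simp
  also have "\<dots> = v \<bullet> (?C *\<^sub>v conjugate v)"
    using transpose_vec_mult_scalar[OF C cv v(1)] symC by simp
  also have "\<dots> = cnj a * (v \<bullet>c v)" using v cv by (simp add: conj_eig)
  finally have "a = cnj a" using v by simp
  then have "a = complex_of_real (Re a)" by (metis Reals_cnj_iff of_real_Re)
  then have "poly (char_poly ?C) (complex_of_real (Re a)) = 0"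
    using root eigenvalue_root_char_poly[OF C] by simp
  then have "poly (char_poly A) (Re a) = 0"
    unfolding of_real_hom.char_poly_hom[OF A] by simp
  then show ?thesis using eigenvalue_root_char_poly[OF A] by blast
qed

text \<open>Gram-Schmidt leaves the first vector of a basis unchanged, so after normalization the
  first column is still a multiple of \<open>v\<close>; the scalar is harmless because multiples of
  eigenvectors are used.\<close>

lemma orthonormal_completion:
  fixes v :: "real vec"
  assumes v: "v \<in> carrier_vec n" and v0: "v \<noteq> 0\<^sub>v n" and n: "n \<noteq> 0"
  shows "\<exists>W \<in> carrier_mat n n. \<exists>c. transpose_mat W * W = 1\<^sub>m n \<and> col W 0 = c \<cdot>\<^sub>v v"
proof -
  interpret cof_vec_space n "TYPE(real)" .
  from basis_completion[OF v v0]
  have span_b: "span (set (basis_completion v)) = carrier_vec n"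
    and dist_b: "distinct (basis_completion v)"
    and indep: "\<not> lin_dep (set (basis_completion v))"
    and b: "set (basis_completion v) \<subseteq> carrier_vec n"
    and hdb: "hd (basis_completion v) = v"
    and len_b: "length (basis_completion v) = n" by auto
  define ws where "ws = gram_schmidt n (basis_completion v)"
  from gram_schmidt_result[OF b dist_b indep refl, folded ws_def]
  have ws: "set ws \<subseteq> carrier_vec n" "corthogonal ws" "length ws = n"
    by (auto simp: len_b)
  from hdb len_b n obtain vs where bv: "basis_completion v = v # vs"
    by (cases "basis_completion v") auto
  have "hd ws = v" unfolding ws_def bv using gram_schmidt_hd[OF v] .
  then have ws0: "ws ! 0 = v" using ws(3) n by (metis hd_conv_nth length_0_conv)
  have car: "ws ! i \<in> carrier_vec n" if "i < n" for i using ws that by auto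
  have orth: "ws ! i \<bullet> ws ! j = 0 \<longleftrightarrow> i \<noteq> j" if "i < n" "j < n" for i j
    using corthogonalD[OF ws(2), of i j] that ws(3) car by simp
  define r where "r i = sqrt (ws ! i \<bullet> ws ! i)" for i
  have pos: "ws ! i \<bullet> ws ! i > 0" if "i < n" for i
  proof -
    have "ws ! i \<bullet> ws ! i \<ge> 0" unfolding scalar_prod_def by (intro sum_nonneg) simp
    moreover have "ws ! i \<bullet> ws ! i \<noteq> 0" using orth[OF that that] by simp
    ultimately show ?thesis by simp
  qed
  define W where "W = mat_of_cols n (map (\<lambda>i. (1 / r i) \<cdot>\<^sub>v ws ! i) [0..<n])"
  have W: "W \<in> carrier_mat n n" unfolding W_def by auto
  have col: "col W i = (1 / r i) \<cdot>\<^sub>v ws ! i" if "i < n" for i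
    unfolding W_def using that car by (subst col_mat_of_cols) auto
  have "transpose_mat W * W = 1\<^sub>m n"
  proof (rule eq_matI)
    fix i j assume "i < dim_row (1\<^sub>m n :: real mat)" "j < dim_col (1\<^sub>m n :: real mat)"
    then have ij: "i < n" "j < n" by auto
    have "(transpose_mat W * W) $$ (i, j) = col W i \<bullet> col W j"
      using W ij by simp
    also have "\<dots> = (1 / r i) * (1 / r j) * (ws ! i \<bullet> ws ! j)"
      using car[OF ij(1)] car[OF ij(2)] ij by (simp add: col)
    also have "\<dots> = 1\<^sub>m n $$ (i, j)"
      using orth[OF ij] pos[OF ij(1)] ij by (auto simp: r_def field_simps)
    finally show "(transpose_mat W * W) $$ (i, j) = 1\<^sub>m n $$ (i, j)" .
  qed (use W in auto)
  moreover have "col W 0 = (1 / r 0) \<cdot>\<^sub>v v" using col[of 0] n ws0 by simp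
  ultimately show ?thesis using W by blast
qed

text \<open>Induction on the dimension: an orthonormal change of basis makes an eigenvector the
  first coordinate direction, symmetry splits off a block of size 1, and the remaining block is
  again symmetric.\<close>

lemma real_spectral_decomposition:
  fixes A :: "real mat"
  assumes "A \<in> carrier_mat n n" and "transpose_mat A = A"
  shows "\<exists>U \<in> carrier_mat n n. \<exists>D \<in> carrier_mat n n.
    transpose_mat U * U = 1\<^sub>m n \<and> diagonal_mat D \<and> A = U * D * transpose_mat U"
  using assms
proof (induction n arbitrary: A)
  case 0
  then show ?case
    by (intro bexI[of _ "1\<^sub>m 0"] bexI[of _ "A"]) (auto simp: diagonal_mat_def)
next
  case (Suc n A)
  let ?N = "Suc n"
  note A = Suc.prems(1) and sym = Suc.prems(2)
  obtain e where "eigenvalue A e"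
    using real_symmetric_eigenvalue_exists[OF A sym] by auto
  then obtain v where v: "v \<in> carrier_vec ?N" "v \<noteq> 0\<^sub>v ?N" "A *\<^sub>v v = e \<cdot>\<^sub>v v"
    using A unfolding eigenvalue_def eigenvector_def by auto
  obtain W c where W: "W \<in> carrier_mat ?N ?N" and WW: "transpose_mat W * W = 1\<^sub>m ?N"
    and c: "col W 0 = c \<cdot>\<^sub>v v"
    using orthonormal_completion[OF v(1,2)] by blast
  let ?Wt = "transpose_mat W"
  have Wt: "?Wt \<in> carrier_mat ?N ?N" using W by simp
  have WW': "W * ?Wt = 1\<^sub>m ?N" using mat_mult_left_right_inverse[OF Wt W WW] .
  define B where "B = ?Wt * A * W"
  have B: "B \<in> carrier_mat ?N ?N" using W A unfolding B_def by simp
  have Bsym: "transpose_mat B = B"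
    unfolding B_def using W A Wt sym
    by (simp add: transpose_mult[of _ ?N ?N _ ?N] assoc_mult_mat[of _ ?N ?N _ ?N _ ?N])
  have Aw: "A *\<^sub>v col W 0 = e \<cdot>\<^sub>v col W 0"
    unfolding c using A v by (simp add: mult_mat_vec smult_smult_assoc mult.commute)
  \<comment> \<open>Column 0 of \<open>A * W\<close> is \<open>e\<close> times column 0 of
    \<open>W\<close>, so orthonormality clears the first column of \<open>B\<close> below the
    diagonal. Symmetry of \<open>B\<close> then clears the first row as well.\<close>
  have col0: "B $$ (i, 0) = (if i = 0 then e else 0)" if i: "i < ?N" for i
  proof -
    have "B = ?Wt * (A * W)" unfolding B_def using Wt A W by simp
    then have "B $$ (i, 0) = col W i \<bullet> col (A * W) 0"
      using Wt A W i by simp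
    also have "col (A * W) 0 = e \<cdot>\<^sub>v col W 0" using col_mult2[OF A W, of 0] Aw by simp
    also have "col W i \<bullet> (e \<cdot>\<^sub>v col W 0) = e * (?Wt * W) $$ (i, 0)"
      using W i by simp
    finally show ?thesis using i by (simp add: WW)
  qed
  have row0: "B $$ (0, j) = (if j = 0 then e else 0)" if j: "j < ?N" for j
    using col0[OF j] Bsym B j by (metis carrier_matD index_transpose_mat(1) zero_less_Suc)
  define B3 where "B3 = mat n n (\<lambda>(i, j). B $$ (Suc i, Suc j))"
  have B3: "B3 \<in> carrier_mat n n" unfolding B3_def by simp
  have "transpose_mat B3 = B3"
    unfolding B3_def
    by (rule eq_matI) (use Bsym B in \<open>auto, metis Suc_less_eq carrier_matD index_transpose_mat(1)\<close>)
  then obtain U D where U: "U \<in> carrier_mat n n" and D: "D \<in> carrier_mat n n"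
    and UU: "transpose_mat U * U = 1\<^sub>m n" and diag: "diagonal_mat D"
    and B3_eq: "B3 = U * D * transpose_mat U"
    using Suc.IH[OF B3] by blast
  let ?E = "mat 1 1 (\<lambda>_. e)"
  let ?z = "0\<^sub>m 1 n" and ?z' = "0\<^sub>m n 1"
  have E: "?E \<in> carrier_mat 1 1" by simp
  have Ut: "transpose_mat U \<in> carrier_mat n n" using U by simp
  have B_eq: "B = four_block_mat ?E ?z ?z' B3"
    by (rule eq_matI) (use B col0 row0 in \<open>auto simp: B3_def split: nat.split\<close>)
  define U' where "U' = four_block_mat (1\<^sub>m 1) ?z ?z' U"
  define D' where "D' = four_block_mat ?E ?z ?z' D"
  have U': "U' \<in> carrier_mat ?N ?N" unfolding U'_def using U
    by (metis Suc_eq_plus1_left four_block_carrier_mat one_carrier_mat)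
  have D': "D' \<in> carrier_mat ?N ?N" unfolding D'_def using D E
    by (metis Suc_eq_plus1_left four_block_carrier_mat)
  have U't: "transpose_mat U' = four_block_mat (1\<^sub>m 1) ?z ?z' (transpose_mat U)"
    unfolding U'_def using U by (subst transpose_four_block_mat[of _ 1 1 _ n _ n]) auto
  have U'U': "transpose_mat U' * U' = 1\<^sub>m ?N"
    unfolding U't unfolding U'_def
    by (subst mult_four_block_mat[OF one_carrier_mat zero_carrier_mat zero_carrier_mat Ut
        one_carrier_mat zero_carrier_mat zero_carrier_mat U])
      (use U Ut UU in auto)
  have "U' * D' = four_block_mat ?E ?z ?z' (U * D)"
    unfolding U'_def D'_def
    by (subst mult_four_block_mat[OF one_carrier_mat zero_carrier_mat zero_carrier_mat U
        E zero_carrier_mat zero_carrier_mat D])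
      (use U D E in auto)
  then have "U' * D' * transpose_mat U' = four_block_mat ?E ?z ?z' (U * D * transpose_mat U)"
    unfolding U't
    by (simp only:, subst mult_four_block_mat[OF E zero_carrier_mat zero_carrier_mat _
        one_carrier_mat zero_carrier_mat zero_carrier_mat Ut])
      (use U D E Ut in auto)
  then have BUD: "B = U' * D' * transpose_mat U'" unfolding B_eq B3_eq by simp
  have U't_car: "transpose_mat U' \<in> carrier_mat ?N ?N" using U' by simp
  note assoc = assoc_mult_mat[of _ ?N ?N _ ?N _ ?N]
  let ?P = "W * U'"
  have P: "?P \<in> carrier_mat ?N ?N" using W U' by simp
  have Pt: "transpose_mat ?P = transpose_mat U' * ?Wt"
    using transpose_mult[OF W U'] .
  have "transpose_mat ?P * ?P = transpose_mat U' * (?Wt * W) * U'"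
    unfolding Pt using W Wt U' U't_car by (simp add: assoc)
  also have "\<dots> = 1\<^sub>m ?N" using WW U'U' U't_car by simp
  finally have PP: "transpose_mat ?P * ?P = 1\<^sub>m ?N" .
  have "A = (W * ?Wt) * A * (W * ?Wt)" using A by (simp add: WW')
  also have "\<dots> = W * B * ?Wt" unfolding B_def using W Wt A by (simp add: assoc)
  also have "\<dots> = ?P * D' * transpose_mat ?P"
    unfolding Pt BUD using W Wt U' U't_car D' by (simp add: assoc)
  finally have "A = ?P * D' * transpose_mat ?P" .
  moreover have "diagonal_mat D'"
    using diag D unfolding diagonal_mat_def D'_def by auto
  ultimately show ?case using P PP D' by blast
qed

section \<open>Counting eigenvalues\<close>

lemma order_prod_list_linear:
  fixes r :: "'a::idom"
  shows "Polynomial.order r (\<Prod>a\<leftarrow>as. [:- a, 1:]) = count_list as r"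
proof (induction as)
  case (Cons a as)
  have nz: "(\<Prod>b\<leftarrow>bs. [:- b, 1:]) \<noteq> 0" for bs :: "'a list"
    by (auto simp: prod_list_zero_iff)
  have "Polynomial.order r (\<Prod>b\<leftarrow>a # as. [:- b, 1:]) = Polynomial.order r [:- a, 1:] + Polynomial.order r (\<Prod>b\<leftarrow>as. [:- b, 1:])"
    using nz[of "a # as"] by (simp only: list.map prod_list.Cons Polynomial.order_mult not_False_eq_True)
  also have "Polynomial.order r [:- a, 1:] = (if a = r then 1 else 0)"
    using order_linear_power[of r "- a" 1] by auto
  finally show ?case using Cons.IH by simp
qed simp

text \<open>The order of a root is its number of occurrences in \<open>as\<close>, so summing orders
  over distinct roots amounts to counting list positions.\<close>

lemma num_eigs_ge_eq_length_filter:
  assumes "char_poly A = (\<Prod>a\<leftarrow>as. [:- a, 1:])"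
  shows "num_eigs_ge A c = length (filter (\<lambda>a. a \<ge> c) as)"
proof -
  have "{r. poly (char_poly A) r = 0 \<and> r \<ge> c} = set (filter (\<lambda>a. a \<ge> c) as)"
    unfolding assms by (auto simp: poly_prod_list prod_list_zero_iff)
  then have "num_eigs_ge A c = (\<Sum>r \<in> set (filter (\<lambda>a. a \<ge> c) as). count_list as r)"
    unfolding num_eigs_ge_def assms by (simp add: order_prod_list_linear)
  also have "\<dots> = (\<Sum>r \<in> set (filter (\<lambda>a. a \<ge> c) as). count_list (filter (\<lambda>a. a \<ge> c) as) r)"
    by (rule sum.cong) (auto simp: count_list_eq_length_filter intro!: arg_cong[of _ _ length] filter_cong)
  also have "\<dots> = length (filter (\<lambda>a. a \<ge> c) as)"
    by (simp add: sum_count_set)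
  finally show ?thesis .
qed

text \<open>The system is padded with zero rows to a square matrix. Row \<open>q\<close> is such a
  row, so the transpose kills the unit vector at \<open>q\<close>; the determinant vanishes and a
  kernel vector exists.\<close>

lemma exists_kernel_vector_of_fewer_equations:
  fixes f :: "nat \<Rightarrow> nat \<Rightarrow> 'a::field"
  assumes "q < m"
  shows "\<exists>c \<in> carrier_vec m. c \<noteq> 0\<^sub>v m \<and> (\<forall>i<q. (\<Sum>j<m. f i j * c $ j) = 0)"
proof -
  define M where "M = mat m m (\<lambda>(i, j). if i < q then f i j else 0)"
  have M: "M \<in> carrier_mat m m" unfolding M_def by simp
  have "transpose_mat M *\<^sub>v unit_vec m q = 0\<^sub>v m"
    using assms M by (intro eq_vecI) (auto simp: M_def)
  moreover have "unit_vec m q \<noteq> (0\<^sub>v m :: 'a vec)" using assms by simp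
  ultimately have "det (transpose_mat M) = 0"
    using M by (subst det_0_iff_vec_prod_zero[of _ m]) (auto intro!: exI[of _ "unit_vec m q"])
  then have "det M = 0" using det_transpose[OF M] by simp
  then obtain c where c: "c \<in> carrier_vec m" "c \<noteq> 0\<^sub>v m" "M *\<^sub>v c = 0\<^sub>v m"
    using det_0_iff_vec_prod_zero[OF M] by auto
  have "(\<Sum>j<m. f i j * c $ j) = 0" if "i < q" for i
  proof -
    have "(\<Sum>j<m. f i j * c $ j) = (M *\<^sub>v c) $ i"
      using that assms c(1) by (simp add: M_def scalar_prod_def lessThan_atLeast0)
    then show ?thesis using c(3) that assms by simp
  qed
  then show ?thesis using c by blast
qed

text \<open>The easy half of the Courant--Fischer principle: the subspace on which the form is
  large is the range of \<^term>\<open>W\<close>.\<close>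

lemma num_eigs_ge_lower_bound:
  fixes A W :: "real mat"
  assumes A: "A \<in> carrier_mat n n" and sym: "transpose_mat A = A"
    and W: "W \<in> carrier_mat n m"
    and inj: "\<And>c. c \<in> carrier_vec m \<Longrightarrow> c \<noteq> 0\<^sub>v m \<Longrightarrow> W *\<^sub>v c \<noteq> 0\<^sub>v n"
    and form: "\<And>c. c \<in> carrier_vec m \<Longrightarrow>
      (W *\<^sub>v c) \<bullet> (A *\<^sub>v (W *\<^sub>v c)) \<ge> r * ((W *\<^sub>v c) \<bullet> (W *\<^sub>v c))"
  shows "m \<le> num_eigs_ge A r"
proof (rule ccontr)
  assume "\<not> m \<le> num_eigs_ge A r"
  obtain U D where U: "U \<in> carrier_mat n n" and D: "D \<in> carrier_mat n n"
    and UU: "transpose_mat U * U = 1\<^sub>m n" and diag: "diagonal_mat D"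
    and AUD: "A = U * D * transpose_mat U"
    using real_spectral_decomposition[OF A sym] by blast
  have Ut: "transpose_mat U \<in> carrier_mat n n" using U by simp
  have UU': "U * transpose_mat U = 1\<^sub>m n" using mat_mult_left_right_inverse[OF Ut U UU] .
  have "similar_mat A D"
    using A U D Ut UU UU' AUD by (intro similar_matI) auto
  then have "char_poly A = char_poly D" by (rule char_poly_similar)
  also have "\<dots> = (\<Prod>a\<leftarrow>diag_mat D. [:- a, 1:])"
    using D diag by (intro char_poly_upper_triangular) (auto simp: diagonal_mat_def)
  finally have "num_eigs_ge A r = length (filter (\<lambda>a. a \<ge> r) (diag_mat D))"
    by (rule num_eigs_ge_eq_length_filter)
  also have "\<dots> = length (filter (\<lambda>i. D $$ (i, i) \<ge> r) [0..<n])"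
    using D by (simp add: diag_mat_def filter_map o_def)
  finally have num: "num_eigs_ge A r = length (filter (\<lambda>i. D $$ (i, i) \<ge> r) [0..<n])" .
  \<comment> \<open>The positions of the eigenvalues that are at least \<open>r\<close>. If there
    are fewer than \<open>m\<close>, a dimension count gives a nonzero \<open>c\<close> for which
    \<open>W *\<^sub>v c\<close> has no component along the corresponding eigenvectors.\<close>
  define ks where "ks = filter (\<lambda>i. D $$ (i, i) \<ge> r) [0..<n]"
  have "length ks < m" using num \<open>\<not> m \<le> _\<close> unfolding ks_def by simp
  then obtain c where c: "c \<in> carrier_vec m" "c \<noteq> 0\<^sub>v m"
    and ker: "\<And>i. i < length ks \<Longrightarrow> (\<Sum>j<m. (transpose_mat U * W) $$ (ks ! i, j) * c $ j) = 0"
    using exists_kernel_vector_of_fewer_equations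
      [of "length ks" m "\<lambda>i j. (transpose_mat U * W) $$ (ks ! i, j)"] by blast
  define x where "x = W *\<^sub>v c"
  define y where "y = transpose_mat U *\<^sub>v x"
  have x: "x \<in> carrier_vec n" unfolding x_def using W c by simp
  have y: "y \<in> carrier_vec n" unfolding y_def using Ut x by simp
  have Uy: "U *\<^sub>v y = x"
    unfolding y_def using U Ut x UU' by (simp flip: assoc_mult_mat_vec)
  have "x \<noteq> 0\<^sub>v n" unfolding x_def using inj c by simp
  then have "y \<noteq> 0\<^sub>v n" using Uy U by auto
  then obtain k where k: "k < n" "y $ k \<noteq> 0" using y by (metis carrier_vecD eq_vecI index_zero_vec)
  have y0: "y $ i = 0" if i: "i < n" and "D $$ (i, i) \<ge> r" for i
  proof -
    have "i \<in> set ks" unfolding ks_def using that by simp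
    then obtain l where l: "l < length ks" "ks ! l = i" by (metis in_set_conv_nth)
    have "y = (transpose_mat U * W) *\<^sub>v c"
      unfolding y_def x_def using Ut W c by simp
    then have "y $ i = (\<Sum>j<m. (transpose_mat U * W) $$ (i, j) * c $ j)"
      using i Ut W c by (simp add: mult_mat_vec_def scalar_prod_def lessThan_atLeast0)
    then show ?thesis using ker[OF l(1)] l(2) by simp
  qed
  have "x \<bullet> x = x \<bullet> (U *\<^sub>v y)" by (simp add: Uy)
  also have "\<dots> = y \<bullet> y" unfolding y_def
    using transpose_vec_mult_scalar[OF U, of y x] x y by (simp add: y_def)
  finally have xx: "x \<bullet> x = (\<Sum>i<n. (y $ i)\<^sup>2)"
    using y by (simp add: scalar_prod_def lessThan_atLeast0 power2_eq_square)
  have Dy: "D *\<^sub>v y = vec n (\<lambda>i. D $$ (i, i) * y $ i)"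
  proof (rule eq_vecI)
    fix i assume "i < dim_vec (vec n (\<lambda>i. D $$ (i, i) * y $ i))"
    then have i: "i < n" by simp
    have "(D *\<^sub>v y) $ i = (\<Sum>j<n. D $$ (i, j) * y $ j)"
      using i D y by (simp add: scalar_prod_def lessThan_atLeast0)
    also have "\<dots> = (\<Sum>j<n. if j = i then D $$ (i, i) * y $ i else 0)"
      using diag D i by (intro sum.cong) (auto simp: diagonal_mat_def)
    finally show "(D *\<^sub>v y) $ i = vec n (\<lambda>i. D $$ (i, i) * y $ i) $ i" using i by simp
  qed (use D in simp)
  have Dyc: "D *\<^sub>v y \<in> carrier_vec n" using D y by simp
  have "A *\<^sub>v x = U *\<^sub>v (D *\<^sub>v y)"
    unfolding AUD y_def
    using assoc_mult_mat_vec[OF mult_carrier_mat[OF U D] Ut x] assoc_mult_mat_vec[OF U D y]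
    by (simp add: y_def)
  then have "x \<bullet> (A *\<^sub>v x) = y \<bullet> (D *\<^sub>v y)"
    using transpose_vec_mult_scalar[OF U Dyc x] by (simp add: y_def)
  also have "\<dots> = (\<Sum>i<n. D $$ (i, i) * (y $ i)\<^sup>2)"
    unfolding Dy using y by (simp add: scalar_prod_def lessThan_atLeast0 power2_eq_square ac_simps)
  finally have xAx: "x \<bullet> (A *\<^sub>v x) = (\<Sum>i<n. D $$ (i, i) * (y $ i)\<^sup>2)" .
  \<comment> \<open>Only coordinates with eigenvalue below \<open>r\<close> survive in
    \<open>y\<close>, and the nonzero coordinate \<open>k\<close> makes the inequality
    strict.\<close>
  have "(\<Sum>i<n. D $$ (i, i) * (y $ i)\<^sup>2) < (\<Sum>i<n. r * (y $ i)\<^sup>2)"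
  proof (rule sum_strict_mono_ex1)
    show "\<forall>i\<in>{..<n}. D $$ (i, i) * (y $ i)\<^sup>2 \<le> r * (y $ i)\<^sup>2"
    proof
      fix i assume "i \<in> {..<n}"
      then show "D $$ (i, i) * (y $ i)\<^sup>2 \<le> r * (y $ i)\<^sup>2"
        using y0[of i] by (cases "D $$ (i, i) \<ge> r") (auto intro!: mult_right_mono)
    qed
    have "D $$ (k, k) < r" using y0[of k] k by force
    then show "\<exists>i\<in>{..<n}. D $$ (i, i) * (y $ i)\<^sup>2 < r * (y $ i)\<^sup>2"
      using k by (intro bexI[of _ k]) auto
  qed simp
  then have "x \<bullet> (A *\<^sub>v x) < r * (x \<bullet> x)"
    unfolding xAx xx by (simp add: sum_distrib_left)
  moreover have "x \<bullet> (A *\<^sub>v x) \<ge> r * (x \<bullet> x)" unfolding x_def using form c by simp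
  ultimately show False by simp
qed

text \<open>Here \<open>r\<close> is both the common squared norm and the eigenvalue threshold. The
  Gram matrix is \<open>r\<close> times the identity, so on the span the sum of squared inner
  products equals \<open>r\<close> times the squared norm; the same relation shows that the family
  is independent.\<close>

lemma orthogonal_family_le_num_eigs_ge:
  fixes A :: "real mat" and f :: "'b \<Rightarrow> nat \<Rightarrow> real"
  assumes A: "A \<in> carrier_mat n n" and sym: "transpose_mat A = A"
    and T: "finite T" and r: "r > 0"
    and orth: "\<And>t t'. t \<in> T \<Longrightarrow> t' \<in> T \<Longrightarrow> t \<noteq> t' \<Longrightarrow> (\<Sum>i<n. f t i * f t' i) = 0"
    and norm: "\<And>t. t \<in> T \<Longrightarrow> (\<Sum>i<n. f t i * f t i) = r"
    and form: "\<And>x. x \<in> carrier_vec n \<Longrightarrow>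
      (\<Sum>t\<in>T. (\<Sum>i<n. f t i * x $ i)\<^sup>2) \<le> x \<bullet> (A *\<^sub>v x)"
  shows "card T \<le> num_eigs_ge A r"
proof -
  let ?m = "card T"
  obtain h where h: "bij_betw h {..<?m} T"
    using ex_bij_betw_nat_finite[OF T] by (auto simp: lessThan_atLeast0)
  have hT: "h j \<in> T" if "j < ?m" for j using h that by (auto simp: bij_betw_def)
  have gram: "(\<Sum>i<n. f (h l) i * f (h j) i) = (if j = l then r else 0)" if "l < ?m" "j < ?m" for l j
  proof (cases "j = l")
    case True
    then show ?thesis using norm[OF hT[OF that(1)]] by simp
  next
    case False
    then have "h l \<noteq> h j" using h that by (auto simp: bij_betw_def inj_on_def)
    then show ?thesis using orth[OF hT[OF that(1)] hT[OF that(2)]] False by simp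
  qed
  define W where "W = mat n ?m (\<lambda>(i, j). f (h j) i)"
  have W: "W \<in> carrier_mat n ?m" unfolding W_def by simp
  have Wc: "(W *\<^sub>v c) $ i = (\<Sum>j<?m. f (h j) i * c $ j)" if "c \<in> carrier_vec ?m" "i < n" for c i
    using that by (simp add: W_def scalar_prod_def lessThan_atLeast0)
  have circ: "(\<Sum>i<n. f (h l) i * (W *\<^sub>v c) $ i) = r * c $ l"
    if c: "c \<in> carrier_vec ?m" and l: "l < ?m" for c l
  proof -
    have "(\<Sum>i<n. f (h l) i * (W *\<^sub>v c) $ i) = (\<Sum>i<n. \<Sum>j<?m. f (h l) i * f (h j) i * c $ j)"
      by (rule sum.cong) (auto simp: Wc[OF c] sum_distrib_left mult.assoc)
    also have "\<dots> = (\<Sum>j<?m. (\<Sum>i<n. f (h l) i * f (h j) i) * c $ j)"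
      by (subst sum.swap) (simp add: sum_distrib_right)
    also have "\<dots> = (\<Sum>j<?m. if j = l then r * c $ j else 0)"
      by (rule sum.cong) (use gram[OF l] in auto)
    finally show ?thesis using l by simp
  qed
  have Wcar: "W *\<^sub>v c \<in> carrier_vec n" if "c \<in> carrier_vec ?m" for c :: "real vec"
    using W that by simp
  have sq: "(W *\<^sub>v c) \<bullet> (W *\<^sub>v c) = r * (\<Sum>j<?m. (c $ j)\<^sup>2)" if c: "c \<in> carrier_vec ?m" for c
  proof -
    have "(W *\<^sub>v c) \<bullet> (W *\<^sub>v c) = (\<Sum>i<n. (W *\<^sub>v c) $ i * (W *\<^sub>v c) $ i)"
      using W by (simp add: scalar_prod_def lessThan_atLeast0)
    also have "\<dots> = (\<Sum>i<n. \<Sum>j<?m. c $ j * (f (h j) i * (W *\<^sub>v c) $ i))"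
    proof (rule sum.cong)
      fix i assume "i \<in> {..<n}"
      then have "(W *\<^sub>v c) $ i * (W *\<^sub>v c) $ i = (\<Sum>j<?m. f (h j) i * c $ j) * (W *\<^sub>v c) $ i"
        using Wc[OF c] by simp
      then show "(W *\<^sub>v c) $ i * (W *\<^sub>v c) $ i = (\<Sum>j<?m. c $ j * (f (h j) i * (W *\<^sub>v c) $ i))"
        unfolding sum_distrib_right by (simp only: ac_simps)
    qed simp
    also have "\<dots> = (\<Sum>j<?m. c $ j * (\<Sum>i<n. f (h j) i * (W *\<^sub>v c) $ i))"
      by (subst sum.swap) (simp only: sum_distrib_left)
    also have "\<dots> = (\<Sum>j<?m. r * (c $ j)\<^sup>2)"
      by (rule sum.cong) (auto simp: circ[OF c] power2_eq_square)
    finally show ?thesis by (simp add: sum_distrib_left)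
  qed
  show ?thesis
  proof (rule num_eigs_ge_lower_bound[OF A sym W])
    fix c :: "real vec" assume c: "c \<in> carrier_vec ?m" and c0: "c \<noteq> 0\<^sub>v ?m"
    obtain k where k: "k < ?m" "c $ k \<noteq> 0" using c c0 by (metis carrier_vecD eq_vecI index_zero_vec)
    show "W *\<^sub>v c \<noteq> 0\<^sub>v n"
    proof
      assume "W *\<^sub>v c = 0\<^sub>v n"
      then have "r * c $ k = 0" unfolding circ[OF c k(1), symmetric] by simp
      then show False using k r by simp
    qed
  next
    fix c :: "real vec" assume c: "c \<in> carrier_vec ?m"
    have "r * ((W *\<^sub>v c) \<bullet> (W *\<^sub>v c)) = (\<Sum>j<?m. (r * c $ j)\<^sup>2)"
      unfolding sq[OF c] sum_distrib_left by (simp add: power2_eq_square ac_simps)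
    also have "\<dots> = (\<Sum>j<?m. (\<Sum>i<n. f (h j) i * (W *\<^sub>v c) $ i)\<^sup>2)"
      by (rule sum.cong) (auto simp: circ[OF c])
    also have "\<dots> = (\<Sum>t\<in>T. (\<Sum>i<n. f t i * (W *\<^sub>v c) $ i)\<^sup>2)"
      by (rule sum.reindex_bij_betw[OF h])
    also have "\<dots> \<le> (W *\<^sub>v c) \<bullet> (A *\<^sub>v (W *\<^sub>v c))"
      using form Wcar[OF c] by blast
    finally show "(W *\<^sub>v c) \<bullet> (A *\<^sub>v (W *\<^sub>v c)) \<ge> r * ((W *\<^sub>v c) \<bullet> (W *\<^sub>v c))" .
  qed
qed

section \<open>Packing triangles in a clique\<close>

text \<open>Besides \<open>m\<close> itself, such a triple arises by exchanging one of the 3 points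
  of \<open>m\<close> for one of the \<open>card S - 3\<close> points outside it. This is the origin
  of the denominator in the final bound.\<close>

lemma triples_meeting_in_pair_card_le:
  assumes S: "finite S" and m: "m \<subseteq> S" "card m = 3"
  shows "card {t. t \<subseteq> S \<and> card t = 3 \<and> card (m \<inter> t) \<ge> 2} \<le> 1 + 3 * (card S - 3)"
proof -
  let ?f = "\<lambda>(a, v). insert v (m - {a})"
  have fm: "finite m" using m S finite_subset by blast
  have sub: "{t. t \<subseteq> S \<and> card t = 3 \<and> card (m \<inter> t) \<ge> 2} \<subseteq> insert m (?f ` (m \<times> (S - m)))"
  proof
    fix t assume "t \<in> {t. t \<subseteq> S \<and> card t = 3 \<and> card (m \<inter> t) \<ge> 2}"
    then have t: "t \<subseteq> S" "card t = 3" "card (m \<inter> t) \<ge> 2" by auto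
    have ft: "finite t" using t S finite_subset by blast
    have "card (m - t) = card m - card (m \<inter> t)" "card (t - m) = card t - card (m \<inter> t)"
      using fm ft by (auto simp: card_Diff_subset_Int Int_commute)
    moreover have "card (m \<inter> t) \<le> 3" using m(2) fm by (metis card_mono Int_lower1)
    ultimately consider "card (m - t) = 0" "card (t - m) = 0" | "card (m - t) = 1" "card (t - m) = 1"
      using t m by linarith
    then show "t \<in> insert m (?f ` (m \<times> (S - m)))"
    proof cases
      case 1
      then show ?thesis using fm ft by auto
    next
      case 2
      then obtain a v where av: "m - t = {a}" "t - m = {v}" by (meson card_1_singletonE)
      then have "t = ?f (a, v)" by auto
      moreover have "(a, v) \<in> m \<times> (S - m)" using av t by auto
      ultimately show ?thesis by blast
    qed
  qed
  have "card (insert m (?f ` (m \<times> (S - m)))) \<le> Suc (card (m \<times> (S - m)))"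
    using S fm card_image_le[of "m \<times> (S - m)" ?f] by (simp add: card_insert_if le_SucI)
  also have "\<dots> = 1 + 3 * (card S - 3)"
    using m fm by (simp add: card_cartesian_product card_Diff_subset)
  finally show ?thesis
    using card_mono[OF _ sub] S fm by simp
qed

text \<open>A packing that is maximal under inclusion suffices: any triple sharing at most one point
  with each member could be added, so the triples blocked by the members cover everything, and a
  union bound gives the estimate.\<close>

lemma exists_large_triple_packing:
  assumes S: "finite S"
  shows "\<exists>M \<subseteq> {t. t \<subseteq> S \<and> card t = 3}. pairwise (\<lambda>t t'. card (t \<inter> t') \<le> 1) M \<and>
    card S choose 3 \<le> card M * (1 + 3 * (card S - 3))"
proof -
  define X where "X = {t. t \<subseteq> S \<and> card t = 3}"
  define F where "F = {M. M \<subseteq> X \<and> pairwise (\<lambda>t t'. card (t \<inter> t') \<le> 1) M}"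
  have X: "finite X" unfolding X_def using S by simp
  then have "finite F" unfolding F_def by simp
  moreover have "{} \<in> F" unfolding F_def by simp
  then have "F \<noteq> {}" by blast
  ultimately have "\<exists>M\<in>F. \<forall>M'\<in>F. M \<subseteq> M' \<longrightarrow> M = M'" by (rule finite_has_maximal)
  then obtain M where M: "M \<in> F" and maximal: "\<forall>M'\<in>F. M \<subseteq> M' \<longrightarrow> M = M'" ..
  have MX: "M \<subseteq> X" using M unfolding F_def by simp
  have cover: "\<exists>m\<in>M. card (m \<inter> t) \<ge> 2" if t: "t \<in> X" for t
  proof (rule ccontr)
    assume "\<not> (\<exists>m\<in>M. card (m \<inter> t) \<ge> 2)"
    then have far: "card (m \<inter> t) \<le> 1" if "m \<in> M" for m using that by force
    then have "insert t M \<in> F"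
      using M t unfolding F_def by (auto simp: pairwise_insert Int_commute)
    then have "M = insert t M" using bspec[OF maximal, of "insert t M"] by auto
    then have "t \<in> M" by auto
    \<comment> \<open>A triple meets itself in three points, so it cannot be a member and also be
      far from all members.\<close>
    then show False using far[of t] t unfolding X_def by simp
  qed
  have "card S choose 3 = card X" unfolding X_def using S by (simp add: n_subsets)
  also have "\<dots> \<le> card (\<Union>m\<in>M. {t. t \<subseteq> S \<and> card t = 3 \<and> card (m \<inter> t) \<ge> 2})"
  proof (rule card_mono)
    show "finite (\<Union>m\<in>M. {t. t \<subseteq> S \<and> card t = 3 \<and> card (m \<inter> t) \<ge> 2})"
      using finite_subset[OF MX X] S by auto
    show "X \<subseteq> (\<Union>m\<in>M. {t. t \<subseteq> S \<and> card t = 3 \<and> card (m \<inter> t) \<ge> 2})"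
      using cover unfolding X_def by blast
  qed
  also have "\<dots> \<le> (\<Sum>m\<in>M. card {t. t \<subseteq> S \<and> card t = 3 \<and> card (m \<inter> t) \<ge> 2})"
    using finite_subset[OF MX X] by (rule card_UN_le)
  also have "\<dots> \<le> (\<Sum>m\<in>M. 1 + 3 * (card S - 3))"
    using MX unfolding X_def by (intro sum_mono triples_meeting_in_pair_card_le[OF S]) auto
  finally have "card S choose 3 \<le> card M * (1 + 3 * (card S - 3))" by simp
  then show ?thesis using M unfolding F_def X_def by blast
qed

section \<open>The Helmholtzian as a Hodge Laplacian\<close>

text \<open>The unit flow along the directed pair \<open>(a, b)\<close>, read in the chosen
  orientation of the edges: traversing an edge backwards costs a sign.\<close>

definition edge_sign :: "'a \<Rightarrow> 'a \<Rightarrow> 'a \<times> 'a \<Rightarrow> real" where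
  "edge_sign a b e = of_bool (e = (a, b)) - of_bool (e = (b, a))"

text \<open>An entry of the signed vertex-edge incidence matrix, that is, of the boundary map from
  edges to vertices.\<close>

definition boundary_coeff :: "'a \<Rightarrow> 'a \<times> 'a \<Rightarrow> real" where
  "boundary_coeff v e = of_bool (snd e = v) - of_bool (fst e = v)"

text \<open>An entry of the boundary map from triangles to edges: the unit flow around the directed
  cycle through \<open>a\<close>, \<open>b\<close>, \<open>c\<close>.\<close>

definition triangle_flow :: "'a \<Rightarrow> 'a \<Rightarrow> 'a \<Rightarrow> 'a \<times> 'a \<Rightarrow> real" where
  "triangle_flow a b c e = edge_sign a b e + edge_sign b c e + edge_sign c a e"

text \<open>Using all orderings avoids choosing an orientation for each triangle. Reordering changes
  the flow at most by a sign, so products of two values of the same flow do not depend on the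
  ordering.\<close>

definition ordered_triangles :: "'a set \<Rightarrow> ('a \<times> 'a) list \<Rightarrow> ('a \<times> 'a \<times> 'a) set" where
  "ordered_triangles V es =
     {(a, b, c). a \<in> V \<and> b \<in> V \<and> c \<in> V \<and> adj es a b \<and> adj es b c \<and> adj es a c}"

lemma adj_commute: "adj es u v \<longleftrightarrow> adj es v u"
  by (auto simp: adj_def insert_commute)

lemma adj_edge:
  assumes "oriented_simple_graph V es" and "(p, q) \<in> set es"
  shows "adj es p q" "p \<in> V" "q \<in> V" "p \<noteq> q"
  using assms by (force simp: oriented_simple_graph_def adj_def undir_def)+

lemma edge_eq_of_undir_eq:
  assumes "oriented_simple_graph V es" and "e \<in> set es" and "e' \<in> set es" and "undir e = undir e'"
  shows "e = e'"
  using assms by (auto simp: oriented_simple_graph_def distinct_map inj_on_def)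

lemma triangle_flow_rotate: "triangle_flow b c a = triangle_flow a b c"
  by (auto simp: triangle_flow_def)

lemma triangle_flow_swap: "triangle_flow b a c e = - triangle_flow a b c e"
  by (auto simp: triangle_flow_def edge_sign_def)

lemma finite_ordered_triangles: "finite V \<Longrightarrow> finite (ordered_triangles V es)"
  by (rule finite_subset[of _ "V \<times> V \<times> V"]) (auto simp: ordered_triangles_def)

lemma ordered_triangles_rotate:
  "(b, c, a) \<in> ordered_triangles V es \<longleftrightarrow> (a, b, c) \<in> ordered_triangles V es"
  using adj_commute[of es c a] adj_commute[of es b a] unfolding ordered_triangles_def by blast

lemma sum_ordered_triangles_rotate:
  "(\<Sum>(a, b, c) \<in> ordered_triangles V es. f b c a) = (\<Sum>(a, b, c) \<in> ordered_triangles V es. f a b c)"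
  by (rule sum.reindex_bij_witness[where i = "\<lambda>(a, b, c). (c, a, b)" and j = "\<lambda>(a, b, c). (b, c, a)"])
    (auto simp: ordered_triangles_rotate)

lemma sum_ordered_triangles_at_edge:
  assumes V: "finite V" and p: "p \<in> V" and q: "q \<in> V" and pq: "adj es p q"
  shows "(\<Sum>(a, b, c) \<in> ordered_triangles V es. of_bool ((p, q) = (a, b)) * f a b c)
    = (\<Sum>w \<in> {w \<in> V. adj es w p \<and> adj es w q}. (f p q w :: real))"
proof -
  have "(\<Sum>(a, b, c) \<in> ordered_triangles V es. of_bool ((p, q) = (a, b)) * f a b c)
    = (\<Sum>(a, b, c) \<in> {(a, b, c) \<in> ordered_triangles V es. (p, q) = (a, b)}. f a b c)"
    using finite_ordered_triangles[OF V]
    by (intro sum.mono_neutral_cong_right) auto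
  also have "\<dots> = (\<Sum>w \<in> {w \<in> V. adj es w p \<and> adj es w q}. f p q w)"
    by (rule sum.reindex_bij_witness[where i = "\<lambda>w. (p, q, w)" and j = "\<lambda>(a, b, c). c"])
      (use p q pq in \<open>auto simp: ordered_triangles_def intro: adj_commute[THEN iffD1]\<close>)
  finally show ?thesis .
qed

text \<open>Expanding the first flow gives three edge signs, which contribute equally by rotation;
  each sees the edge in two directions, and the two signs of a reversal cancel. Hence the factor 3
  times 2.\<close>

lemma sum_triangle_flow_mult:
  assumes V: "finite V" and p: "p \<in> V" and q: "q \<in> V" and pq: "adj es p q"
  shows "(\<Sum>(a, b, c) \<in> ordered_triangles V es. triangle_flow a b c (p, q) * triangle_flow a b c e')
    = 6 * (\<Sum>w \<in> {w \<in> V. adj es w p \<and> adj es w q}. triangle_flow p q w e')"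
proof -
  let ?T = "ordered_triangles V es"
  let ?F = "\<lambda>a b c. triangle_flow a b c e'"
  let ?G = "\<lambda>a b c. edge_sign a b (p, q) * ?F a b c"
  let ?N = "\<lambda>p q. {w \<in> V. adj es w p \<and> adj es w q}"
  have "(\<Sum>(a, b, c) \<in> ?T. triangle_flow a b c (p, q) * ?F a b c)
      = (\<Sum>(a, b, c) \<in> ?T. ?G a b c + ?G b c a + ?G c a b)"
  proof -
    have "triangle_flow a b c (p, q) * ?F a b c = ?G a b c + ?G b c a + ?G c a b" for a b c
    proof -
      have "?F b c a = ?F a b c" "?F c a b = ?F a b c"
        by (metis triangle_flow_rotate)+
      then show ?thesis by (simp only: triangle_flow_def[of a b c "(p, q)"] distrib_right)
    qed
    then show ?thesis by simp
  qed
  also have "\<dots> = (\<Sum>(a, b, c) \<in> ?T. ?G a b c) + (\<Sum>(a, b, c) \<in> ?T. ?G b c a) + (\<Sum>(a, b, c) \<in> ?T. ?G c a b)"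
    by (simp add: case_prod_unfold sum.distrib)
  also have "(\<Sum>(a, b, c) \<in> ?T. ?G c a b) = (\<Sum>(a, b, c) \<in> ?T. ?G b c a)"
    using sum_ordered_triangles_rotate[of "\<lambda>a b c. ?G b c a"] by simp
  also have "(\<Sum>(a, b, c) \<in> ?T. ?G b c a) = (\<Sum>(a, b, c) \<in> ?T. ?G a b c)"
    by (rule sum_ordered_triangles_rotate)
  also have "(\<Sum>(a, b, c) \<in> ?T. ?G a b c)
      = (\<Sum>(a, b, c) \<in> ?T. of_bool ((p, q) = (a, b)) * ?F a b c)
        - (\<Sum>(a, b, c) \<in> ?T. of_bool ((q, p) = (a, b)) * ?F a b c)"
  proof -
    have "edge_sign a b (p, q) = of_bool ((p, q) = (a, b)) - of_bool ((q, p) = (a, b))" for a b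
      by (simp add: edge_sign_def conj_commute)
    then show ?thesis
      by (simp only: case_prod_unfold left_diff_distrib sum_subtractf)
  qed
  also have "(\<Sum>(a, b, c) \<in> ?T. of_bool ((p, q) = (a, b)) * ?F a b c) = (\<Sum>w \<in> ?N p q. ?F p q w)"
    by (rule sum_ordered_triangles_at_edge[OF V p q pq])
  also have "(\<Sum>(a, b, c) \<in> ?T. of_bool ((q, p) = (a, b)) * ?F a b c) = (\<Sum>w \<in> ?N q p. ?F q p w)"
    using pq by (intro sum_ordered_triangles_at_edge[OF V q p]) (simp add: adj_commute)
  also have "(\<Sum>w \<in> ?N q p. ?F q p w) = - (\<Sum>w \<in> ?N p q. ?F p q w)"
    unfolding sum_negf[symmetric] by (rule sum.cong) (auto simp: triangle_flow_swap[of q p])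
  finally show ?thesis by simp
qed

lemma sum_boundary_coeff_mult:
  assumes V: "finite V" and "p \<in> V" "q \<in> V"
  shows "(\<Sum>v\<in>V. boundary_coeff v (p, q) * boundary_coeff v (p', q'))
    = of_bool (q = q') - of_bool (q = p') - of_bool (p = q') + of_bool (p = p')"
proof -
  have "(\<Sum>v\<in>V. boundary_coeff v (p, q) * boundary_coeff v (p', q'))
    = (\<Sum>v\<in>V. if v = q then of_bool (q = q') - of_bool (q = p') else 0)
      - (\<Sum>v\<in>V. if v = p then of_bool (p = q') - of_bool (p = p') else (0::real))"
    unfolding sum_subtractf[symmetric]
    by (rule sum.cong) (auto simp: boundary_coeff_def of_bool_def)
  then show ?thesis using assms by simp
qed

text \<open>The two edges already use three distinct vertices, so the third side of any common
  triangle joins \<open>y\<close> and \<open>z\<close>. This replaces an existential by the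
  adjacency that the sum over common neighbours produces.\<close>

lemma in_common_tri_iff_adj:
  assumes "undir e = {x, y}" and "undir e' = {x, z}" and "y \<noteq> z"
    and "adj es x y" and "adj es x z"
  shows "in_common_tri es e e' \<longleftrightarrow> adj es y z"
proof
  have ne: "x \<noteq> y" "x \<noteq> z" using assms(4,5) by (auto simp: adj_def)
  show "adj es y z" if "in_common_tri es e e'"
  proof -
    from that obtain a b c where abc: "adj es a b" "adj es b c" "adj es a c"
      and "undir e \<subseteq> {a, b, c}" "undir e' \<subseteq> {a, b, c}"
      unfolding in_common_tri_def by blast
    then have "y \<in> {a, b, c}" "z \<in> {a, b, c}" unfolding assms(1,2) by auto
    then show ?thesis using abc \<open>y \<noteq> z\<close> by (auto intro: adj_commute[THEN iffD1])
  qed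
  show "in_common_tri es e e'" if "adj es y z"
    unfolding in_common_tri_def assms(1,2) using that assms(3-5) ne
    by (intro conjI exI[of _ x] exI[of _ y] exI[of _ z]) (auto simp: doubleton_eq_iff)
qed

lemma sum_of_bool_member:
  assumes "finite N"
  shows "(\<Sum>w\<in>N. of_bool (P \<and> x = w)) = (of_bool (P \<and> x \<in> N) :: real)"
  using assms by (cases P) (auto simp: of_bool_def)

text \<open>The vertex part yields 2 on the diagonal, 1 for a shared head or tail and -1 for a head
  meeting a tail. The triangle part adds the number of triangles on the diagonal; off the diagonal
  it is nonzero only for edges of a common triangle, where it is opposite to the vertex part. That
  cancellation explains the zeros of the matrix.\<close>

lemma helm_entry_eq:
  assumes G: "oriented_simple_graph V es" and e: "e \<in> set es" and e': "e' \<in> set es"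
  shows "helm_entry V es e e' = (\<Sum>v\<in>V. boundary_coeff v e * boundary_coeff v e')
    + (\<Sum>(a, b, c) \<in> ordered_triangles V es. triangle_flow a b c e * triangle_flow a b c e') / 6"
proof -
  obtain p q p' q' where pq: "e = (p, q)" and pq': "e' = (p', q')" by (cases e, cases e') auto
  note adj = adj_edge[OF G e[unfolded pq]] and adj' = adj_edge[OF G e'[unfolded pq']]
  have V: "finite V" using G by (simp add: oriented_simple_graph_def)
  define N where "N = {w \<in> V. adj es w p \<and> adj es w q}"
  have N: "finite N" using V unfolding N_def by simp
  have "(\<Sum>v\<in>V. boundary_coeff v e * boundary_coeff v e')
      + (\<Sum>(a, b, c) \<in> ordered_triangles V es. triangle_flow a b c e * triangle_flow a b c e') / 6
    = of_bool (q = q') - of_bool (q = p') - of_bool (p = q') + of_bool (p = p')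
      + (\<Sum>w \<in> N. triangle_flow p q w e')"
    unfolding pq sum_triangle_flow_mult[OF V adj(2,3,1)]
    unfolding pq' sum_boundary_coeff_mult[OF V adj(2,3)] N_def by simp
  also have "\<dots> = helm_entry V es e e'"
  proof (cases "e = e'")
    case True
    have "triangle_flow p q w e' = 1" if "w \<in> N" for w
      using that adj(4) True unfolding pq
      by (auto simp: triangle_flow_def edge_sign_def N_def adj_def)
    then have "(\<Sum>w \<in> N. triangle_flow p q w e') = real (card N)" by simp
    then show ?thesis using True adj(4) unfolding pq pq'
      by (auto simp: helm_entry_def ntri_def N_def)
  next
    case False
    have undir_ne: "undir e \<noteq> undir e'" using edge_eq_of_undir_eq[OF G e e'] False by auto
    then have ne: "(p', q') \<noteq> (q, p)" "(p', q') \<noteq> (p, q)"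
      by (auto simp: undir_def pq pq')
    \<comment> \<open>Since \<open>e'\<close> is neither \<open>e\<close> nor its reversal, only the
      two other sides of the triangle contribute, and each of the four terms matches one way for
      \<open>e'\<close> to meet \<open>e\<close>.\<close>
    have flow: "triangle_flow p q w e' = of_bool (p' = q \<and> q' = w) - of_bool (q' = q \<and> p' = w)
        + of_bool (q' = p \<and> p' = w) - of_bool (p' = p \<and> q' = w)" for w
    proof -
      have "edge_sign p q e' = 0" using ne by (simp only: edge_sign_def pq')
      then show ?thesis by (simp add: triangle_flow_def edge_sign_def pq' conj_commute)
    qed
    have "(\<Sum>w \<in> N. triangle_flow p q w e')
      = (\<Sum>w\<in>N. of_bool (p' = q \<and> q' = w)) - (\<Sum>w\<in>N. of_bool (q' = q \<and> p' = w))
        + (\<Sum>w\<in>N. of_bool (q' = p \<and> p' = w)) - (\<Sum>w\<in>N. of_bool (p' = p \<and> q' = w))"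
      by (simp only: flow sum.distrib sum_subtractf)
    also have "\<dots> = of_bool (p' = q \<and> q' \<in> N) - of_bool (q' = q \<and> p' \<in> N)
        + of_bool (q' = p \<and> p' \<in> N) - of_bool (p' = p \<and> q' \<in> N)"
      by (simp only: sum_of_bool_member[OF N])
    finally have sum_eq: "(\<Sum>w \<in> N. triangle_flow p q w e')
      = of_bool (p' = q \<and> q' \<in> N) - of_bool (q' = q \<and> p' \<in> N)
        + of_bool (q' = p \<and> p' \<in> N) - of_bool (p' = p \<and> q' \<in> N)" .
    have N_iff: "w \<in> N \<longleftrightarrow> w \<in> V \<and> adj es p w \<and> adj es q w" for w
      by (auto simp: N_def adj_commute)
    have ua: "undir e = {p, q}" "undir e = {q, p}" "undir e' = {p', q'}" "undir e' = {q', p'}"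
      by (auto simp: undir_def pq pq')
    have rev: "adj es q p" "adj es q' p'" using adj(1) adj'(1) adj_commute by metis+
    \<comment> \<open>At most one of the four incidences can hold: two of them would create a loop
      or make the two undirected edges equal.\<close>
    consider "p' = q" | "q' = q" | "q' = p" | "p' = p"
      | "p' \<noteq> q" "q' \<noteq> q" "q' \<noteq> p" "p' \<noteq> p" by blast
    then show ?thesis
    proof cases
      case 1
      then have "in_common_tri es e e' \<longleftrightarrow> adj es p q'"
        using ne ua adj adj' rev by (intro in_common_tri_iff_adj[of e q p e' q']) auto
      then show ?thesis unfolding sum_eq N_iff using 1 ne adj adj' False
        by (auto simp: helm_entry_def head_tail_def pq pq')
    next
      case 2
      then have "in_common_tri es e e' \<longleftrightarrow> adj es p p'"
        using ne ua adj adj' rev by (intro in_common_tri_iff_adj[of e q p e' p']) auto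
      then show ?thesis unfolding sum_eq N_iff using 2 ne adj adj' rev False
        by (auto simp: helm_entry_def head_tail_def same_end_def pq pq')
    next
      case 3
      then have "in_common_tri es e e' \<longleftrightarrow> adj es q p'"
        using ne ua adj adj' rev by (intro in_common_tri_iff_adj[of e p q e' p']) auto
      then show ?thesis unfolding sum_eq N_iff using 3 ne adj adj' rev False
        by (auto simp: helm_entry_def head_tail_def same_end_def pq pq')
    next
      case 4
      then have "in_common_tri es e e' \<longleftrightarrow> adj es q q'"
        using ne ua adj adj' rev by (intro in_common_tri_iff_adj[of e p q e' q']) auto
      then show ?thesis unfolding sum_eq N_iff using 4 ne adj adj' rev False
        by (auto simp: helm_entry_def head_tail_def same_end_def pq pq')
    next
      case 5
      then show ?thesis unfolding sum_eq using False
        by (auto simp: helm_entry_def head_tail_def same_end_def pq pq')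
    qed
  qed
  finally show ?thesis by simp
qed

section \<open>Edge-disjoint triangles\<close>

lemma edge_sign_support:
  assumes "edge_sign a b e \<noteq> 0"
  shows "undir e = {a, b}"
proof -
  have "e = (a, b) \<or> e = (b, a)" using assms unfolding edge_sign_def by fastforce
  then show ?thesis unfolding undir_def by fastforce
qed

lemma triangle_flow_support:
  assumes "triangle_flow a b c e \<noteq> 0"
  shows "undir e \<subseteq> {a, b, c}"
proof -
  have "edge_sign a b e \<noteq> 0 \<or> edge_sign b c e \<noteq> 0 \<or> edge_sign c a e \<noteq> 0"
    using assms by (auto simp: triangle_flow_def)
  then show ?thesis by (auto dest: edge_sign_support)
qed

text \<open>For three distinct vertices the edge signs have disjoint supports, so squaring leaves no
  cross terms.\<close>

lemma triangle_flow_square: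
  assumes "a \<noteq> b" "b \<noteq> c" "a \<noteq> c"
  shows "(triangle_flow a b c e)\<^sup>2
    = of_bool (undir e = {a, b}) + of_bool (undir e = {b, c}) + of_bool (undir e = {c, a})"
proof -
  obtain p q where "e = (p, q)" by (cases e)
  then show ?thesis using assms
    by (auto simp: triangle_flow_def edge_sign_def undir_def doubleton_eq_iff)
qed

lemma sum_undir_eq_one:
  assumes "oriented_simple_graph V es" and "adj es u v"
  shows "(\<Sum>i<length es. of_bool (undir (es ! i) = {u, v})) = (1::real)"
proof -
  obtain k where k: "k < length es" "undir (es ! k) = {u, v}"
    using assms(2) by (auto simp: adj_def in_set_conv_nth)
  have "(undir (es ! i) = {u, v}) = (i = k)" if "i < length es" for i
    using assms(1) k that
    by (auto simp: oriented_simple_graph_def distinct_conv_nth) metis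
  then have "(\<Sum>i<length es. of_bool (undir (es ! i) = {u, v}) :: real) = (\<Sum>i<length es. of_bool (i = k))"
    by (intro sum.cong) auto
  then show ?thesis using k(1) by (simp add: of_bool_def)
qed

lemma sum_triangle_flow_square:
  assumes "oriented_simple_graph V es" and "adj es a b" "adj es b c" "adj es a c"
  shows "(\<Sum>i<length es. (triangle_flow a b c (es ! i))\<^sup>2) = 3"
proof -
  have "a \<noteq> b" "b \<noteq> c" "a \<noteq> c" using assms by (auto simp: adj_def)
  moreover have "adj es c a" using assms(4) adj_commute by metis
  ultimately show ?thesis
    using sum_undir_eq_one[OF assms(1)] assms(2,3)
    by (simp add: triangle_flow_square sum.distrib)
qed

lemma helmholtzian_carrier: "helmholtzian V es \<in> carrier_mat (length es) (length es)"
  by (simp add: helmholtzian_def)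

text \<open>The product formula \<open>helm_entry_eq\<close> is visibly symmetric in the two edges,
  which avoids a case distinction on how they meet.\<close>

lemma helmholtzian_symmetric:
  assumes "oriented_simple_graph V es"
  shows "transpose_mat (helmholtzian V es) = helmholtzian V es"
proof (rule eq_matI)
  fix i j assume "i < dim_row (helmholtzian V es)" "j < dim_col (helmholtzian V es)"
  then have ij: "i < length es" "j < length es" by (simp_all add: helmholtzian_def)
  then show "transpose_mat (helmholtzian V es) $$ (i, j) = helmholtzian V es $$ (i, j)"
    using helm_entry_eq[OF assms, of "es ! i" "es ! j"] helm_entry_eq[OF assms, of "es ! j" "es ! i"]
    by (simp add: helmholtzian_def mult.commute)
qed (simp_all add: helmholtzian_def)

section \<open>The quadratic form and the comparison with a family of triangles\<close>

lemma square_sum_mult: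
  "(\<Sum>i<n. f i * x i)\<^sup>2 = (\<Sum>i<n. \<Sum>k<n. x i * (f i * f k) * (x k :: real))"
proof -
  have "f i * x i * (f k * x k) = x i * (f i * f k) * x k" for i k by (simp only: ac_simps)
  then show ?thesis by (simp only: power2_eq_square sum_product)
qed

text \<open>Each triangle is counted once per ordering of its vertices, hence the factor 6.\<close>

lemma helmholtzian_form:
  assumes G: "oriented_simple_graph V es" and x: "x \<in> carrier_vec (length es)"
  shows "x \<bullet> (helmholtzian V es *\<^sub>v x)
    = (\<Sum>v\<in>V. (\<Sum>i<length es. boundary_coeff v (es ! i) * x $ i)\<^sup>2)
      + (\<Sum>(a, b, c)\<in>ordered_triangles V es.
          (\<Sum>i<length es. triangle_flow a b c (es ! i) * x $ i)\<^sup>2) / 6"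
proof -
  let ?n = "length es" and ?T = "ordered_triangles V es"
  let ?b = "\<lambda>v i. boundary_coeff v (es ! i)"
  let ?t = "\<lambda>z i. case z of (a, b, c) \<Rightarrow> triangle_flow a b c (es ! i)"
  have entry: "helm_entry V es (es ! i) (es ! k)
      = (\<Sum>v\<in>V. ?b v i * ?b v k) + (\<Sum>z\<in>?T. ?t z i * ?t z k) / 6" if "i < ?n" "k < ?n" for i k
    using helm_entry_eq[OF G, of "es ! i" "es ! k"] that by (simp add: case_prod_unfold)
  have "x \<bullet> (helmholtzian V es *\<^sub>v x)
      = (\<Sum>i<?n. \<Sum>k<?n. x $ i * helm_entry V es (es ! i) (es ! k) * x $ k)"
    using x by (simp add: helmholtzian_def scalar_prod_def lessThan_atLeast0 sum_distrib_left mult.assoc)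
  also have "\<dots> = (\<Sum>i<?n. \<Sum>k<?n. (\<Sum>v\<in>V. x $ i * (?b v i * ?b v k) * x $ k)
      + (\<Sum>z\<in>?T. x $ i * (?t z i * ?t z k) * x $ k) / 6)"
    by (intro sum.cong refl)
      (simp only: entry lessThan_iff distrib_left distrib_right sum_distrib_left sum_distrib_right
        times_divide_eq_left times_divide_eq_right)
  also have "\<dots> = (\<Sum>i<?n. \<Sum>k<?n. \<Sum>v\<in>V. x $ i * (?b v i * ?b v k) * x $ k)
      + (\<Sum>i<?n. \<Sum>k<?n. \<Sum>z\<in>?T. x $ i * (?t z i * ?t z k) * x $ k) / 6"
    by (simp only: sum.distrib sum_divide_distrib)
  also have "(\<Sum>i<?n. \<Sum>k<?n. \<Sum>v\<in>V. x $ i * (?b v i * ?b v k) * x $ k)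
      = (\<Sum>v\<in>V. \<Sum>i<?n. \<Sum>k<?n. x $ i * (?b v i * ?b v k) * x $ k)"
    by (subst sum.swap[of _ "{..<?n}" V, symmetric]) (intro sum.cong refl sum.swap)
  also have "(\<Sum>i<?n. \<Sum>k<?n. \<Sum>z\<in>?T. x $ i * (?t z i * ?t z k) * x $ k)
      = (\<Sum>z\<in>?T. \<Sum>i<?n. \<Sum>k<?n. x $ i * (?t z i * ?t z k) * x $ k)"
    by (subst sum.swap[of _ "{..<?n}" ?T, symmetric]) (intro sum.cong refl sum.swap)
  finally show ?thesis
    unfolding square_sum_mult by (simp only: case_prod_unfold)
qed

text \<open>A rotation and a transposition generate all permutations of three letters, so
  \<open>g\<close> is constant on the six orderings.\<close>

lemma sum_orderings_of_triple:
  fixes g :: "'a \<Rightarrow> 'a \<Rightarrow> 'a \<Rightarrow> real"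
  assumes "a \<noteq> b" "b \<noteq> c" "a \<noteq> c"
    and rot: "\<And>u v w. g v w u = g u v w" and swap: "\<And>u v w. g v u w = g u v w"
  shows "(\<Sum>(u, v, w) \<in> {(u, v, w). {u, v, w} \<subseteq> {a, b, c} \<and> distinct [u, v, w]}. g u v w) = 6 * g a b c"
proof -
  have "{(u, v, w). {u, v, w} \<subseteq> {a, b, c} \<and> distinct [u, v, w]}
      = {(a, b, c), (b, c, a), (c, a, b), (b, a, c), (a, c, b), (c, b, a)}"
    using assms(1-3) by auto
  moreover have "g b c a = g a b c" "g c a b = g a b c" "g b a c = g a b c" "g a c b = g a b c" "g c b a = g a b c"
    by (metis rot swap)+
  ultimately show ?thesis using assms(1-3) by simp
qed

text \<open>Each triangle in \<open>T\<close> accounts for six ordered triples, and an ordered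
  triple determines its triangle, so these blocks are disjoint. All other ordered triangles are
  discarded by nonnegativity. The function \<open>z\<close> picks one representative ordering per
  triangle.\<close>

lemma sum_triangles_le_sum_ordered_triangles:
  fixes g :: "'a \<Rightarrow> 'a \<Rightarrow> 'a \<Rightarrow> real"
  assumes V: "finite V" and T: "finite T"
    and tri: "\<And>t. t \<in> T \<Longrightarrow> t \<subseteq> V \<and> card t = 3 \<and> is_clique es t"
    and z: "\<And>t. t \<in> T \<Longrightarrow> case z t of (a, b, c) \<Rightarrow> t = {a, b, c} \<and> a \<noteq> b \<and> b \<noteq> c \<and> a \<noteq> c"
    and rot: "\<And>u v w. g v w u = g u v w" and swap: "\<And>u v w. g v u w = g u v w"
    and nonneg: "\<And>u v w. 0 \<le> g u v w"
  shows "6 * (\<Sum>t\<in>T. case z t of (a, b, c) \<Rightarrow> g a b c)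
    \<le> (\<Sum>(u, v, w)\<in>ordered_triangles V es. g u v w)"
proof -
  define P where "P t = {(u, v, w). {u, v, w} \<subseteq> t \<and> distinct [u, v, w]}" for t :: "'a set"
  have fin: "finite t" if "t \<in> T" for t using tri[OF that] V finite_subset by blast
  have finP: "finite (P t)" if "t \<in> T" for t
    using fin[OF that] by (intro finite_subset[of "P t" "t \<times> t \<times> t"]) (auto simp: P_def)
  have P_eq: "{u, v, w} = t" if "t \<in> T" "(u, v, w) \<in> P t" for t u v w
    using that tri[OF that(1)] fin[OF that(1)] by (intro card_subset_eq) (simp_all add: P_def)
  have sumP: "(\<Sum>(u, v, w)\<in>P t. g u v w) = 6 * (case z t of (a, b, c) \<Rightarrow> g a b c)" if t: "t \<in> T" for t
  proof -
    obtain a b d where abd: "z t = (a, b, d)" by (cases "z t")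
    with z[OF t] have t_eq: "t = {a, b, d}" and ne: "a \<noteq> b" "b \<noteq> d" "a \<noteq> d" by auto
    have "(\<Sum>(u, v, w)\<in>P t. g u v w) = 6 * g a b d"
      unfolding P_def t_eq by (rule sum_orderings_of_triple[OF ne rot swap])
    then show ?thesis by (simp add: abd)
  qed
  have "6 * (\<Sum>t\<in>T. case z t of (a, b, c) \<Rightarrow> g a b c) = (\<Sum>t\<in>T. \<Sum>(u, v, w)\<in>P t. g u v w)"
    by (simp add: sumP sum_distrib_left)
  also have "\<dots> = (\<Sum>(u, v, w)\<in>(\<Union>t\<in>T. P t). g u v w)"
  proof (rule sum.UNION_disjoint[symmetric])
    show "\<forall>t\<in>T. \<forall>t'\<in>T. t \<noteq> t' \<longrightarrow> P t \<inter> P t' = {}"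
    proof (intro ballI impI)
      fix t t' assume t: "t \<in> T" "t' \<in> T" "t \<noteq> t'"
      have False if "(u, v, w) \<in> P t" "(u, v, w) \<in> P t'" for u v w
        using P_eq[OF t(1) that(1)] P_eq[OF t(2) that(2)] t(3) by simp
      then show "P t \<inter> P t' = {}" by (auto simp: disjoint_iff)
    qed
  qed (use T finP in auto)
  also have "\<dots> \<le> (\<Sum>(u, v, w)\<in>ordered_triangles V es. g u v w)"
  proof (rule sum_mono2)
    show "(\<Union>t\<in>T. P t) \<subseteq> ordered_triangles V es"
    proof clarify
      fix t u v w assume t: "t \<in> T" and "(u, v, w) \<in> P t"
      then have "u \<in> t" "v \<in> t" "w \<in> t" "u \<noteq> v" "v \<noteq> w" "u \<noteq> w" by (auto simp: P_def)
      then show "(u, v, w) \<in> ordered_triangles V es"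
        using tri[OF t] by (auto simp: ordered_triangles_def is_clique_def)
    qed
  qed (auto simp: finite_ordered_triangles[OF V] nonneg)
  finally show ?thesis .
qed

text \<open>Two common vertices of two cliques span a common edge, so meeting in at most one vertex
  expresses edge-disjointness. The flows then have disjoint supports and are orthogonal coordinate
  by coordinate.\<close>

lemma edge_disjoint_triangles_le_num_eigs_ge:
  assumes G: "oriented_simple_graph V es"
    and T: "finite T"
    and tri: "\<And>t. t \<in> T \<Longrightarrow> t \<subseteq> V \<and> card t = 3 \<and> is_clique es t"
    and disj: "pairwise (\<lambda>t t'. card (t \<inter> t') \<le> 1) T"
  shows "card T \<le> num_eigs_ge (helmholtzian V es) 3"
proof -
  let ?n = "length es"
  have V: "finite V" using G by (simp add: oriented_simple_graph_def)
  have "\<forall>t\<in>T. \<exists>z. case z of (a, b, c) \<Rightarrow> t = {a, b, c} \<and> a \<noteq> b \<and> b \<noteq> c \<and> a \<noteq> c"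
  proof
    fix t assume "t \<in> T"
    then obtain a b c where "t = {a, b, c}" "a \<noteq> b" "b \<noteq> c" "a \<noteq> c"
      using tri by (metis card_3_iff)
    then show "\<exists>z. case z of (a, b, c) \<Rightarrow> t = {a, b, c} \<and> a \<noteq> b \<and> b \<noteq> c \<and> a \<noteq> c"
      by (intro exI[of _ "(a, b, c)"]) simp
  qed
  from bchoice[OF this] obtain z where
    z_all: "\<forall>t\<in>T. case z t of (a, b, c) \<Rightarrow> t = {a, b, c} \<and> a \<noteq> b \<and> b \<noteq> c \<and> a \<noteq> c" ..
  note z = bspec[OF z_all]
  define fl where "fl t i = (case z t of (a, b, c) \<Rightarrow> triangle_flow a b c (es ! i))" for t i
  have common: "u = v" if "t \<in> T" "t' \<in> T" "t \<noteq> t'" "{u, v} \<subseteq> t" "{u, v} \<subseteq> t'" for t t' u v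
  proof -
    have "finite (t \<inter> t')" using tri[OF that(1)] V finite_subset by blast
    moreover have "card (t \<inter> t') \<le> Suc 0" using disj that(1-3) unfolding pairwise_def by auto
    ultimately show ?thesis using that(4,5) card_le_Suc0_iff_eq by fastforce
  qed
  have supp: "undir (es ! i) \<subseteq> t" if t: "t \<in> T" and ne: "fl t i \<noteq> 0" for t i
  proof -
    obtain a b c where abc: "z t = (a, b, c)" by (cases "z t")
    with z[OF t] have t_eq: "t = {a, b, c}" by simp
    have "triangle_flow a b c (es ! i) \<noteq> 0" using ne by (simp add: fl_def abc)
    then show ?thesis unfolding t_eq by (rule triangle_flow_support)
  qed
  have orth: "fl t i * fl t' i = 0" if "t \<in> T" "t' \<in> T" "t \<noteq> t'" "i < ?n" for t t' i
  proof (rule ccontr)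
    assume "fl t i * fl t' i \<noteq> 0"
    then have ne: "fl t i \<noteq> 0" "fl t' i \<noteq> 0" by auto
    \<comment> \<open>An edge in both supports has both ends in both triangles;
      \<open>common\<close> makes these ends equal, but no edge is a loop.\<close>
    have "fst (es ! i) = snd (es ! i)"
      using common[OF that(1-3)] supp[OF that(1) ne(1)] supp[OF that(2) ne(2)]
      unfolding undir_def by simp
    then show False using G that(4) unfolding oriented_simple_graph_def by auto
  qed
  have norm: "(\<Sum>i<?n. fl t i * fl t i) = 3" if t: "t \<in> T" for t
  proof -
    obtain a b c where abc: "z t = (a, b, c)" by (cases "z t")
    with z[OF t] have "t = {a, b, c}" "a \<noteq> b" "b \<noteq> c" "a \<noteq> c" by auto
    then have "adj es a b" "adj es b c" "adj es a c" using tri[OF t] unfolding is_clique_def by auto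
    then show ?thesis using sum_triangle_flow_square[OF G]
      unfolding fl_def abc by (simp add: power2_eq_square)
  qed
  show ?thesis
  proof (rule orthogonal_family_le_num_eigs_ge[OF helmholtzian_carrier helmholtzian_symmetric[OF G] T])
    show "(\<Sum>i<?n. fl t i * fl t' i) = 0" if "t \<in> T" "t' \<in> T" "t \<noteq> t'" for t t'
      using orth[OF that] by (intro sum.neutral) blast
    show "(\<Sum>i<?n. fl t i * fl t i) = 3" if "t \<in> T" for t
      using norm[OF that] .
    fix x :: "real vec" assume x: "x \<in> carrier_vec ?n"
    define g where "g u v w = (\<Sum>i<?n. triangle_flow u v w (es ! i) * x $ i)\<^sup>2" for u v w
    have rot: "g v w u = g u v w" for u v w
      unfolding g_def by (simp only: triangle_flow_rotate)
    have swap: "g v u w = g u v w" for u v w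
      unfolding g_def triangle_flow_swap[of v u] by (simp add: sum_negf)
    have "6 * (\<Sum>t\<in>T. case z t of (a, b, c) \<Rightarrow> g a b c)
        \<le> (\<Sum>(u, v, w)\<in>ordered_triangles V es. g u v w)"
      by (rule sum_triangles_le_sum_ordered_triangles[OF V T tri z rot swap]) (simp_all add: g_def)
    also have "(\<Sum>t\<in>T. case z t of (a, b, c) \<Rightarrow> g a b c) = (\<Sum>t\<in>T. (\<Sum>i<?n. fl t i * x $ i)\<^sup>2)"
      by (intro sum.cong) (simp_all add: fl_def g_def split: prod.split)
    finally have "(\<Sum>t\<in>T. (\<Sum>i<?n. fl t i * x $ i)\<^sup>2)
        \<le> (\<Sum>(u, v, w)\<in>ordered_triangles V es. g u v w) / 6" by simp
    \<comment> \<open>The squared divergences are dropped here.\<close>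
    also have "\<dots> \<le> x \<bullet> (helmholtzian V es *\<^sub>v x)"
      unfolding helmholtzian_form[OF G x] g_def by (simp add: sum_nonneg)
    finally show "(\<Sum>t\<in>T. (\<Sum>i<?n. fl t i * x $ i)\<^sup>2) \<le> x \<bullet> (helmholtzian V es *\<^sub>v x)" .
  qed simp
qed

theorem theorem5p8:
  fixes V :: "'a set" and es :: "('a \<times> 'a) list"
    and k :: nat and S :: "nat \<Rightarrow> 'a set" and s :: "nat \<Rightarrow> nat"
  assumes G: "oriented_simple_graph V es"
    and sub: "\<And>i. i < k \<Longrightarrow> S i \<subseteq> V"
    and cl: "\<And>i. i < k \<Longrightarrow> is_clique es (S i)"
    and sz: "\<And>i. i < k \<Longrightarrow> card (S i) = s i \<and> s i \<ge> 3"
    and disj: "\<And>i j. i < k \<Longrightarrow> j < k \<Longrightarrow> i \<noteq> j \<Longrightarrow> card (S i \<inter> S j) \<le> 1"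
  shows "real (num_eigs_ge (helmholtzian V es) 3)
           \<ge> (\<Sum>i<k. real (s i choose 3) / (1 + 3 * (real (s i) - 3)))"
proof -
  have V: "finite V" using G by (simp add: oriented_simple_graph_def)
  have fS: "finite (S i)" if "i < k" for i using sub[OF that] V finite_subset by blast
  have "\<forall>i\<in>{..<k}. \<exists>M. M \<subseteq> {t. t \<subseteq> S i \<and> card t = 3} \<and>
      pairwise (\<lambda>t t'. card (t \<inter> t') \<le> 1) M \<and> s i choose 3 \<le> card M * (1 + 3 * (s i - 3))"
  proof
    fix i assume "i \<in> {..<k}"
    then show "\<exists>M. M \<subseteq> {t. t \<subseteq> S i \<and> card t = 3} \<and>
      pairwise (\<lambda>t t'. card (t \<inter> t') \<le> 1) M \<and> s i choose 3 \<le> card M * (1 + 3 * (s i - 3))"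
      using exists_large_triple_packing[OF fS[of i]] sz[of i] by simp
  qed
  from bchoice[OF this] obtain M where M: "\<forall>i\<in>{..<k}. M i \<subseteq> {t. t \<subseteq> S i \<and> card t = 3} \<and>
      pairwise (\<lambda>t t'. card (t \<inter> t') \<le> 1) (M i) \<and>
      s i choose 3 \<le> card (M i) * (1 + 3 * (s i - 3))" ..
  have M_sub: "t \<subseteq> S i" "card t = 3" if "i < k" "t \<in> M i" for i t
    using M that by auto
  have M_pw: "pairwise (\<lambda>t t'. card (t \<inter> t') \<le> 1) (M i)"
    and M_card: "s i choose 3 \<le> card (M i) * (1 + 3 * (s i - 3))" if "i < k" for i
    using M that by auto
  have fM: "finite (M i)" if "i < k" for i
    using M_sub(1)[OF that] fS[OF that] by (meson Pow_iff finite_Pow_iff finite_subset subsetI)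
  \<comment> \<open>Triangles from different cliques inherit the bound on the intersection from the
    cliques. Applied to a single triangle of three vertices, this also shows that the chosen
    families are disjoint, so their sizes add up.\<close>
  have cross: "card (t \<inter> t') \<le> 1" if "i < k" "j < k" "i \<noteq> j" "t \<in> M i" "t' \<in> M j" for i j t t'
  proof -
    have "t \<inter> t' \<subseteq> S i \<inter> S j" using M_sub(1) that by blast
    then have "card (t \<inter> t') \<le> card (S i \<inter> S j)"
      using fS that(1) by (intro card_mono) auto
    then show ?thesis using disj[OF that(1-3)] by simp
  qed
  define T where "T = (\<Union>i<k. M i)"
  have "card T = (\<Sum>i<k. card (M i))"
    unfolding T_def
  proof (rule card_UN_disjoint)
    show "\<forall>i\<in>{..<k}. \<forall>j\<in>{..<k}. i \<noteq> j \<longrightarrow> M i \<inter> M j = {}"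
    proof (intro ballI impI)
      fix i j assume ij: "i \<in> {..<k}" "j \<in> {..<k}" "i \<noteq> j"
      have False if "t \<in> M i" "t \<in> M j" for t
        using cross[of i j t t] M_sub(2)[of i t] ij that by simp
      then show "M i \<inter> M j = {}" by blast
    qed
  qed (use fM in auto)
  moreover have "card T \<le> num_eigs_ge (helmholtzian V es) 3"
  proof (rule edge_disjoint_triangles_le_num_eigs_ge[OF G])
    show "finite T" unfolding T_def using fM by simp
    show "pairwise (\<lambda>t t'. card (t \<inter> t') \<le> 1) T"
    proof (rule pairwiseI)
      fix t t' assume "t \<in> T" "t' \<in> T" "t \<noteq> t'"
      then obtain i j where "i < k" "j < k" "t \<in> M i" "t' \<in> M j" unfolding T_def by blast
      then show "card (t \<inter> t') \<le> 1"
        using cross[of i j t t'] pairwiseD[OF M_pw, of i t t'] \<open>t \<noteq> t'\<close> by blast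
    qed
    fix t assume "t \<in> T"
    then obtain i where i: "i < k" "t \<in> M i" unfolding T_def by blast
    then show "t \<subseteq> V \<and> card t = 3 \<and> is_clique es t"
      using M_sub[OF i] sub[OF i(1)] cl[OF i(1)] unfolding is_clique_def by blast
  qed
  moreover have "real (s i choose 3) / (1 + 3 * (real (s i) - 3)) \<le> real (card (M i))" if i: "i < k" for i
  proof -
    have "real (s i choose 3) \<le> real (card (M i) * (1 + 3 * (s i - 3)))"
      using M_card[OF i] of_nat_le_iff by blast
    \<comment> \<open>The truncated subtraction agrees with the real one because \<open>s i\<close>
      is at least 3, which also makes the denominator positive.\<close>
    also have "\<dots> = real (card (M i)) * (1 + 3 * (real (s i) - 3))"
      using sz[OF i] by (simp add: of_nat_diff algebra_simps)
    finally show ?thesis using sz[OF i] by (simp add: pos_divide_le_eq)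
  qed
  then have "(\<Sum>i<k. real (s i choose 3) / (1 + 3 * (real (s i) - 3))) \<le> (\<Sum>i<k. real (card (M i)))"
    by (intro sum_mono) simp
  ultimately show ?thesis by (simp flip: of_nat_sum)
qed

end
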